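(* Let $n\ge 2$, let $C_1,\dots,C_n$ be events in a probability space, and put $P_i=P[C_i]$, $P_{ij}=P[C_i\cap C_j]$. Then for every $m\in\{1,\dots,n-1\}$, $$P\Big[\bigcup_{i=1}^n C_i\Big]\;\le\; B_m:=\sum_{i=1}^{n}\Big[P_i-\max_{1\le j_1<j_2<\dots<j_{k}<i}\Big\{\sum_{r=1}^{k}\Big[P_{j_r i}-\sum_{s=1}^{r-1}\min\big(P_{j_r i},P_{j_s i},P_{j_r j_s}\big)\Big]^+\Big\}\Big],$$ where, in the $i$-th summand, $k=\min(m,i-1)$.
   Context: Notation: $[x]^+=\max(x,0)$. Empty sums are $0$; for $i=1$ we have $k=0$ and the maximum is $0$, so the first summand is $P_1$. The events $C_i$ are the minimal cut sets of a system whose failure event is $\bigcup_i C_i$; no independence or disjointness is assumed. $B_m$ is called the level $m$ second order upper bound. *)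

theory Defs
  imports "HOL-Probability.Probability"
begin

definition pos_part :: "real \<Rightarrow> real" where
  "pos_part x = max x 0"

text \<open>The lists of length \<open>k\<close> represent the index tuples
  \<open>1 \<le> j\<^sub>1 < \<dots> < j\<^sub>k < i\<close>; since list positions start at 0,
  \<open>j\<^sub>r\<close> is \<open>js ! (r - 1)\<close>.\<close>

definition increasing_tuples :: "nat \<Rightarrow> nat \<Rightarrow> nat list set" where
  "increasing_tuples k i =
    {js. length js = k \<and> sorted_wrt (<) js \<and> (\<forall>j\<in>set js. 1 \<le> j \<and> j < i)}"

definition tuple_sum ::
    "'a measure \<Rightarrow> (nat \<Rightarrow> 'a set) \<Rightarrow> nat \<Rightarrow> nat list \<Rightarrow> real" where
  "tuple_sum M C i js =
    (let P = (\<lambda>a b. measure M (C a \<inter> C b)) in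
     \<Sum>r<length js.
       pos_part (P (js ! r) i
         - (\<Sum>s<r. min (P (js ! r) i) (min (P (js ! s) i) (P (js ! r) (js ! s))))))"

text \<open>The set under \<open>Max\<close> is finite, and it is nonempty because
  \<open>min m (i - 1) \<le> i - 1\<close>; for \<open>i = 1\<close> it is \<open>{0}\<close>,
  coming from the empty tuple.\<close>

definition second_order_upper_bound ::
    "'a measure \<Rightarrow> (nat \<Rightarrow> 'a set) \<Rightarrow> nat \<Rightarrow> nat \<Rightarrow> real" where
  "second_order_upper_bound M C n m =
    (\<Sum>i = 1..n. measure M (C i)
       - Max (tuple_sum M C i ` increasing_tuples (min m (i - 1)) i))"

end

theory Submission
  imports Defs
begin

text \<open>Disjointifying the union, the \<open>i\<close>-th summand becomes
  \<open>P\<^sub>i\<close> minus the probability of \<open>C\<^sub>i \<inter> \<Union>\<^sub>j\<^sub><\<^sub>i C\<^sub>j\<close>. Keeping only the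
  indices of a tuple and disjointifying once more bounds the latter from below by the
  tuple sum, because each triple intersection is at most the minimum of the three pairwise
  ones.\<close>

context finite_measure
begin

text \<open>Induction on \<open>k\<close>: the last set adds exactly the part of it outside the
  union of its predecessors.\<close>

lemma measure_UNION_lessThan_eq_sum_Diff:
  fixes A :: "nat \<Rightarrow> 'a set"
  assumes "\<And>r. r < k \<Longrightarrow> A r \<in> sets M"
  shows "measure M (\<Union>r<k. A r) = (\<Sum>r<k. measure M (A r - (\<Union>s<r. A s)))"
  using assms
proof (induction k)
  case (Suc k)
  have "measure M (\<Union>r<Suc k. A r) = measure M ((\<Union>r<k. A r) \<union> A k)"
    by (simp add: lessThan_Suc Un_commute)
  also have "\<dots> = measure M (\<Union>r<k. A r) + measure M (A k - (\<Union>r<k. A r))"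
    using Suc.prems by (intro finite_measure_Union') (auto intro!: sets.finite_UN)
  finally show ?case
    using Suc by simp
qed simp

text \<open>Subadditivity bounds the part of \<open>A\<close> that the sets \<open>B s\<close>
  remove.\<close>

lemma measure_Diff_UNION_ge:
  assumes "finite S" "A \<in> sets M" "\<And>s. s \<in> S \<Longrightarrow> B s \<in> sets M"
  shows "measure M A - (\<Sum>s\<in>S. measure M (A \<inter> B s)) \<le> measure M (A - (\<Union>s\<in>S. B s))"
proof -
  have "measure M (A \<inter> (\<Union>s\<in>S. B s)) = measure M (\<Union>s\<in>S. A \<inter> B s)"
    by simp
  also have "\<dots> \<le> (\<Sum>s\<in>S. measure M (A \<inter> B s))"
    using assms by (intro measure_UNION_le) auto
  finally show ?thesis
    using assms finite_measure_Diff'[of A "\<Union>s\<in>S. B s"] by (simp add: sets.finite_UN)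
qed

text \<open>Each summand bounds from below what its entry newly adds when the sets
  \<open>C j \<inter> C i\<close> are united in the order of \<open>js\<close>; these disjoint gains
  add up to the right-hand side.\<close>

lemma tuple_sum_le_measure:
  assumes "C i \<in> sets M" "\<And>j. j \<in> set js \<Longrightarrow> C j \<in> sets M"
  shows "tuple_sum M C i js \<le> measure M (C i \<inter> (\<Union>j\<in>set js. C j))"
proof -
  define A where "A r = C (js ! r) \<inter> C i" for r
  have sets_A: "A r \<in> sets M" if "r < length js" for r
    using assms that by (auto simp: A_def)
  have le: "pos_part (measure M (A r) - (\<Sum>s<r. min (measure M (A r))
        (min (measure M (A s)) (measure M (C (js ! r) \<inter> C (js ! s))))))
      \<le> measure M (A r - (\<Union>s<r. A s))" (is "pos_part (_ - sum ?m _) \<le> _")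
    if r: "r < length js" for r
  proof -
    \<comment> \<open>\<open>A r \<inter> A s\<close> is a triple intersection, hence contained in
      each of the three pairwise intersections under the minimum.\<close>
    have "(\<Sum>s<r. measure M (A r \<inter> A s)) \<le> sum ?m {..<r}"
      using r sets_A assms
      by (intro sum_mono) (auto intro!: finite_measure_mono simp: A_def)
    moreover have "measure M (A r) - (\<Sum>s<r. measure M (A r \<inter> A s))
        \<le> measure M (A r - (\<Union>s<r. A s))"
      using r sets_A by (intro measure_Diff_UNION_ge) auto
    \<comment> \<open>Taking the positive part keeps the bound, since a measure is
      nonnegative.\<close>
    ultimately show ?thesis
      by (simp add: pos_part_def)
  qed
  have "tuple_sum M C i js \<le> (\<Sum>r<length js. measure M (A r - (\<Union>s<r. A s)))"
    unfolding tuple_sum_def Let_def using le by (intro sum_mono) (simp add: A_def)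
  also have "\<dots> = measure M (\<Union>r<length js. A r)"
    using sets_A by (rule measure_UNION_lessThan_eq_sum_Diff[symmetric])
  also have "(\<Union>r<length js. A r) = C i \<inter> (\<Union>j\<in>set js. C j)"
    by (auto simp: A_def set_conv_nth)
  finally show ?thesis .
qed

end

lemma finite_increasing_tuples: "finite (increasing_tuples k i)"
  by (rule finite_subset[OF _ finite_lists_length_eq[of "{1..<i}" k]])
    (auto simp: increasing_tuples_def)

lemma increasing_tuples_nonempty:
  assumes "k \<le> i - 1"
  shows "increasing_tuples k i \<noteq> {}"
proof -
  \<comment> \<open>The witness is the tuple 1, ..., \<open>k\<close>, empty for
    \<open>k = 0\<close>.\<close>
  have "[1..<Suc k] \<in> increasing_tuples k i"
    using assms by (auto simp: increasing_tuples_def simp del: upt_Suc)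
  then show ?thesis by blast
qed

theorem mainTheorem1:
  fixes M :: "'a measure" and C :: "nat \<Rightarrow> 'a set" and n m :: nat
  assumes "prob_space M"
    and "n \<ge> 2"
    and "\<And>i. i \<in> {1..n} \<Longrightarrow> C i \<in> sets M"
    and "m \<in> {1..n - 1}"
  shows "measure M (\<Union>i\<in>{1..n}. C i) \<le> second_order_upper_bound M C n m"
proof -
  interpret prob_space M by fact
  \<comment> \<open>Shifts indices: the disjointification counts from 0, the events from 1.\<close>
  have union: "(\<Union>s<r. C (Suc s)) = (\<Union>j\<in>{1..r}. C j)" for r
    by (simp only: image_Suc_lessThan[symmetric] image_image)
  have "measure M (\<Union>i\<in>{1..n}. C i)
      = (\<Sum>r<n. measure M (C (Suc r) - (\<Union>s<r. C (Suc s))))"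
    unfolding union[symmetric]
    using assms(3) by (intro measure_UNION_lessThan_eq_sum_Diff) auto
  also have "\<dots> = (\<Sum>i = 1..n. measure M (C i - (\<Union>j\<in>{1..<i}. C j)))"
    by (simp add: union sum.atLeast1_atMost_eq atLeastLessThanSuc_atLeastAtMost)
  also have "\<dots> \<le> second_order_upper_bound M C n m"
    unfolding second_order_upper_bound_def
  proof (rule sum_mono)
    fix i assume i: "i \<in> {1..n}"
    let ?T = "increasing_tuples (min m (i - 1)) i"
    \<comment> \<open>The maximum is attained, so bounding the sum of one maximizing tuple
      suffices.\<close>
    have "Max (tuple_sum M C i ` ?T) \<in> tuple_sum M C i ` ?T"
      by (intro Max_in) (simp_all add: finite_increasing_tuples increasing_tuples_nonempty)
    then obtain js where js: "js \<in> ?T" and Max_eq: "Max (tuple_sum M C i ` ?T) = tuple_sum M C i js"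
      by blast
    have js_less: "set js \<subseteq> {1..<i}"
      using js by (auto simp: increasing_tuples_def)
    have sets_C: "C j \<in> sets M" if "j \<in> {1..i}" for j
      using assms(3) i that by auto
    have "tuple_sum M C i js \<le> measure M (C i \<inter> (\<Union>j\<in>set js. C j))"
      using i js_less sets_C by (intro tuple_sum_le_measure) auto
    also have "\<dots> \<le> measure M (C i \<inter> (\<Union>j\<in>{1..<i}. C j))"
      using i js_less sets_C by (intro finite_measure_mono) (auto intro!: sets.finite_UN sets.Int)
    \<comment> \<open>Passing to the complement inside \<open>C i\<close> turns the lower bound on
      the overlap with earlier events into an upper bound on the new part.\<close>
    finally show "measure M (C i - (\<Union>j\<in>{1..<i}. C j))
        \<le> measure M (C i) - Max (tuple_sum M C i ` ?T)"
      unfolding Max_eq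
      using i sets_C finite_measure_Diff'[of "C i" "\<Union>j\<in>{1..<i}. C j"]
      by (simp add: sets.finite_UN)
  qed
  finally show ?thesis .
qed

end
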